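(* Let $p$ be a prime such that $p > 3$ and $p \equiv 3 \pmod 8$. Then there exists a permutation of $\mathbb{Z}_p$ destroying arithmetic progressions.
   Context: $\mathbb{Z}_p$ denotes the cyclic group of integers modulo $p$. A permutation of $\mathbb{Z}_p$ is a bijection $\mathbb{Z}_p \to \mathbb{Z}_p$ (not required to be a homomorphism). A permutation $\pi$ of $\mathbb{Z}_p$ is said to destroy arithmetic progressions if there is no triple $(a,b,c)$ of elements of $\mathbb{Z}_p$ satisfying all of: $a,b,c$ are not all equal; $c-b = b-a$ in $\mathbb{Z}_p$; and $\pi(c)-\pi(b) = \pi(b)-\pi(a)$ in $\mathbb{Z}_p$. *)

theory Defs
  imports "HOL-Number_Theory.Number_Theory"
begin

text \<open>Only the additive structure of \<open>R\<close> is used; \<open>x \<ominus>\<^bsub>R\<^esub> y\<close> is subtraction in \<open>R\<close>.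
  \<open>\<int>\<^sub>p\<close> is obtained with \<open>R = residue_ring p\<close>, whose carrier is \<open>{0..p - 1}\<close>.\<close>

definition destroys_arithmetic_progressions :: "('a, 'm) ring_scheme \<Rightarrow> ('a \<Rightarrow> 'a) \<Rightarrow> bool" where
  "destroys_arithmetic_progressions R \<pi> \<longleftrightarrow>
    \<not> (\<exists>a\<in>carrier R. \<exists>b\<in>carrier R. \<exists>c\<in>carrier R.
         \<not> (a = b \<and> b = c) \<and>
         c \<ominus>\<^bsub>R\<^esub> b = b \<ominus>\<^bsub>R\<^esub> a \<and>
         \<pi> c \<ominus>\<^bsub>R\<^esub> \<pi> b = \<pi> b \<ominus>\<^bsub>R\<^esub> \<pi> a)"

end

theory Submission
  imports Defs
begin

text \<open>
  Split \<open>\<int>\<^sub>p\<close> into the lower half \<open>{0..(p - 1) div 2}\<close> and the rest, so that exactly one of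
  \<open>x, -x\<close> lies in each part when \<open>x \<noteq> 0\<close>, and let \<open>\<pi> x\<close> be \<open>16 x\<^sup>2\<close> on the lower half and \<open>-9 x\<^sup>2\<close> elsewhere.
  Suppose that \<open>\<pi>\<close> maps \<open>b - d, b, b + d\<close> to an arithmetic progression. If all three terms lie in
  the same part, then \<open>d = 0\<close>. Otherwise the condition is a quadratic form in \<open>b, d\<close>, and since
  \<open>16\<close>, \<open>9\<close> and \<open>16 + 9 = 25\<close> are all squares, completing the square gives
  \<open>u\<^sup>2 = -v\<^sup>2\<close> when the two ends lie in the same part and \<open>u\<^sup>2 = 2 v\<^sup>2\<close> when they do not.
  Both force \<open>u = v = 0\<close>, because \<open>-1\<close> and \<open>2\<close> are non-residues modulo \<open>p \<equiv> 3 (mod 8)\<close>.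
\<close>

section \<open>Non-residues: Euler's criterion and Gauss's lemma\<close>

text \<open>The hypothesis \<open>[c ^ h = -1]\<close> is Euler's form of non-residuosity. If
  \<open>b\<close> were a unit, so would be \<open>a\<close>; raising \<open>eq\<close> to the power
  \<open>h\<close> and applying Fermat to \<open>a\<close> and \<open>b\<close> would give
  \<open>1 = -1\<close> modulo the odd prime \<open>p\<close>.\<close>

lemma prime_dvd_if_cong_nonresidue_mult_square:
  fixes a b c :: int and p h :: nat
  assumes p: "prime p" "p = 2 * h + 1" and c: "[c ^ h = -1] (mod int p)"
    and eq: "[a\<^sup>2 = c * b\<^sup>2] (mod int p)"
  shows "int p dvd a" "int p dvd b"
proof -
  have ip: "prime (int p)"
    using p(1) by simp
  have fermat: "[x ^ (2 * h) = 1] (mod int p)" if "\<not> int p dvd x" for x :: int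
  proof -
    have "coprime x (int p)"
      using that ip by (meson coprime_commute prime_imp_coprime)
    moreover have "residues (int p)"
      using p(1) prime_gt_1_nat by (simp add: residues_def)
    ultimately have "[x ^ totient p = 1] (mod int p)"
      using residues.euler_theorem[of "int p" x] by simp
    then show ?thesis
      using p by (simp add: totient_prime)
  qed
  show b: "int p dvd b"
  proof (rule ccontr)
    assume nb: "\<not> int p dvd b"
    have h: "h > 0"
      using p by (cases h) auto
    have "\<not> int p dvd c"
    proof
      assume "int p dvd c"
      then have "int p dvd c ^ h"
        using h dvd_power dvd_trans by blast
      then have "int p dvd -1"
        using c cong_dvd_iff by blast
      then show False
        using ip not_prime_unit by auto
    qed
    then have "\<not> int p dvd c * b\<^sup>2"
      using nb ip prime_dvd_mult_iff prime_dvd_power by blast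
    then have "\<not> int p dvd a\<^sup>2"
      using eq cong_dvd_iff by blast
    then have na: "\<not> int p dvd a"
      using dvd_power dvd_trans pos2 by blast
    have "[(a\<^sup>2) ^ h = (c * b\<^sup>2) ^ h] (mod int p)"
      using eq by (rule cong_pow)
    then have "[a ^ (2 * h) = c ^ h * b ^ (2 * h)] (mod int p)"
      by (simp add: power_mult power_mult_distrib)
    moreover have "[c ^ h * b ^ (2 * h) = -1 * 1] (mod int p)"
      using c fermat[OF nb] by (rule cong_mult)
    ultimately have "[1 = -1] (mod int p)"
      using fermat[OF na] by (metis cong_sym cong_trans mult_1_right)
    then have "int p dvd 2"
      by (simp add: cong_iff_dvd_diff)
    then show False
      using p h by (auto dest: zdvd_imp_le)
  qed
  have "int p dvd c * b\<^sup>2"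
    using b by (simp add: power2_eq_square)
  then show "int p dvd a"
    using eq ip cong_dvd_iff prime_dvd_power by blast
qed

text \<open>Gauss's lemma: the sign is \<open>(-1) ^ card G.E\<close>, where \<open>G.E\<close>
  holds the residues above \<open>(p - 1) div 2 = 4 * k + 1\<close> among the doubles of
  \<open>1, ..., 4 * k + 1\<close>. These doubles stay below \<open>p\<close>, so they are the
  \<open>2 * j\<close> with \<open>2 * k + 1 \<le> j\<close>, an odd number \<open>2 * k + 1\<close>
  of them.\<close>

lemma two_power_half_cong_minus_one:
  fixes p k :: nat
  assumes p: "prime p" "p = 8 * k + 3"
  shows "[2 ^ (4 * k + 1) = -1] (mod int p)"
proof -
  interpret G: GAUSS p 2
    using p by unfold_locales (auto simp: cong_0_iff dest: zdvd_imp_le)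
  have half: "(int p - 1) div 2 = 4 * int k + 1"
    using p by simp
  have "G.E = (\<lambda>j. 2 * j) ` {2 * int k + 1 .. 4 * int k + 1}"
    unfolding G.E_def G.C_def G.B_def G.A_def half image_image using p by (force simp: image_iff)
  then have "card G.E = 2 * k + 1"
    by (simp add: card_image inj_on_def)
  moreover have "nat (4 * int k + 1) = 4 * k + 1"
    by simp
  ultimately show ?thesis
    using G.pre_gauss_lemma by (simp add: half)
qed

definition half_square_map :: "nat \<Rightarrow> int \<Rightarrow> int" where
  "half_square_map p x = (if 2 * x < int p then 16 * x\<^sup>2 else - 9 * x\<^sup>2)"

locale prime_3_mod_8 =
  fixes p :: nat
  assumes p_prime: "prime p" and p_gt_3: "p > 3" and p_cong: "[p = 3] (mod 8)"
begin

lemma prime_int_p: "prime (int p)"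
  using p_prime by simp

lemma obtain_k: obtains k where "p = 8 * k + 3"
proof
  show "p = 8 * (p div 8) + 3"
    using p_cong div_mult_mod_eq[of p 8] by (simp add: cong_def)
qed

section \<open>Binary quadratic forms with only the trivial zero modulo \<open>p\<close>\<close>

text \<open>Here \<open>-1\<close> is a non-residue because the exponent
  \<open>(p - 1) div 2 = 4 * k + 1\<close> is odd.\<close>

lemma sum_squares_zeroD:
  assumes "int p dvd a\<^sup>2 + b\<^sup>2"
  shows "int p dvd a" "int p dvd b"
proof -
  obtain k where k: "p = 8 * k + 3"
    by (rule obtain_k)
  have "p = 2 * (4 * k + 1) + 1" "[(-1) ^ (4 * k + 1) = -1] (mod int p)"
    "[a\<^sup>2 = -1 * b\<^sup>2] (mod int p)"
    using k assms by (simp_all add: cong_iff_dvd_diff)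
  note * = prime_dvd_if_cong_nonresidue_mult_square[OF p_prime this]
  show "int p dvd a" "int p dvd b"
    by (fact *)+
qed

lemma square_eq_twice_squareD:
  assumes "int p dvd a\<^sup>2 - 2 * b\<^sup>2"
  shows "int p dvd a" "int p dvd b"
proof -
  obtain k where k: "p = 8 * k + 3"
    by (rule obtain_k)
  have "p = 2 * (4 * k + 1) + 1" "[a\<^sup>2 = 2 * b\<^sup>2] (mod int p)"
    using k assms by (simp_all add: cong_iff_dvd_diff)
  note * = prime_dvd_if_cong_nonresidue_mult_square
    [OF p_prime this(1) two_power_half_cong_minus_one[OF p_prime k] this(2)]
  show "int p dvd a" "int p dvd b"
    by (fact *)+
qed

lemma not_dvd_small: "\<not> int p dvd 2" "\<not> int p dvd 3"
  using p_gt_3 by (auto dest!: zdvd_imp_le)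

lemma dvd_cancel:
  "int p dvd 2 * x \<Longrightarrow> int p dvd x" "int p dvd 3 * x \<Longrightarrow> int p dvd x"
  "int p dvd 4 * x \<Longrightarrow> int p dvd x"
proof -
  show 2: "int p dvd 2 * x \<Longrightarrow> int p dvd x" for x
    using not_dvd_small prime_int_p by (simp add: prime_dvd_mult_iff)
  show "int p dvd 3 * x \<Longrightarrow> int p dvd x"
    using not_dvd_small prime_int_p by (simp add: prime_dvd_mult_iff)
  show "int p dvd x" if "int p dvd 4 * x"
  proof (rule 2, rule 2)
    show "int p dvd 2 * (2 * x)"
      using that by simp
  qed
qed

text \<open>The coefficients are \<open>2 * 16\<close> and \<open>2 * 9\<close>, which arise when a
  whole progression lies in one half.\<close>

lemma dvd_square_cancel:
  "int p dvd 32 * x\<^sup>2 \<Longrightarrow> int p dvd x" "int p dvd 18 * x\<^sup>2 \<Longrightarrow> int p dvd x"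
proof -
  assume "int p dvd 32 * x\<^sup>2"
  then have "int p dvd 2 * (4 * (4 * x\<^sup>2))"
    by simp
  then have "int p dvd x\<^sup>2"
    by (rule dvd_cancel(3)[OF dvd_cancel(3)[OF dvd_cancel(1)]])
  then show "int p dvd x"
    using prime_int_p prime_dvd_power by blast
next
  assume "int p dvd 18 * x\<^sup>2"
  then have "int p dvd 2 * (3 * (3 * x\<^sup>2))"
    by simp
  then have "int p dvd x\<^sup>2"
    by (rule dvd_cancel(2)[OF dvd_cancel(2)[OF dvd_cancel(1)]])
  then show "int p dvd x"
    using prime_int_p prime_dvd_power by blast
qed

text \<open>With \<open>u = 5 * b\<close> and \<open>v = 4 * d\<close> or \<open>v = 3 * d\<close>,
  the first two forms are \<open>u\<^sup>2 + v\<^sup>2\<close> and the last two are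
  \<open>u\<^sup>2 - 2 * v\<^sup>2\<close>.\<close>

lemma dvd_if_dvd_quadratic_form:
  "int p dvd 25 * b\<^sup>2 + 16 * d\<^sup>2 \<Longrightarrow> int p dvd d"
  "int p dvd 25 * b\<^sup>2 + 9 * d\<^sup>2 \<Longrightarrow> int p dvd d"
  "int p dvd 25 * b\<^sup>2 - 32 * d\<^sup>2 \<Longrightarrow> int p dvd d"
  "int p dvd 25 * b\<^sup>2 - 18 * d\<^sup>2 \<Longrightarrow> int p dvd d"
proof -
  have sq: "(5 * b)\<^sup>2 = 25 * b\<^sup>2" "(4 * d)\<^sup>2 = 16 * d\<^sup>2" "(3 * d)\<^sup>2 = 9 * d\<^sup>2"
    "2 * (16 * d\<^sup>2) = 32 * d\<^sup>2" "2 * (9 * d\<^sup>2) = 18 * d\<^sup>2"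
    by (simp_all add: power_mult_distrib)
  note s = sum_squares_zeroD(2)[of "5 * b"] and t = square_eq_twice_squareD(2)[of "5 * b"]
  show "int p dvd 25 * b\<^sup>2 + 16 * d\<^sup>2 \<Longrightarrow> int p dvd d"
    by (rule dvd_cancel(3)[OF s[of "4 * d", unfolded sq]])
  show "int p dvd 25 * b\<^sup>2 + 9 * d\<^sup>2 \<Longrightarrow> int p dvd d"
    by (rule dvd_cancel(2)[OF s[of "3 * d", unfolded sq]])
  show "int p dvd 25 * b\<^sup>2 - 32 * d\<^sup>2 \<Longrightarrow> int p dvd d"
    by (rule dvd_cancel(3)[OF t[of "4 * d", unfolded sq]])
  show "int p dvd 25 * b\<^sup>2 - 18 * d\<^sup>2 \<Longrightarrow> int p dvd d"
    by (rule dvd_cancel(2)[OF t[of "3 * d", unfolded sq]])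
qed

section \<open>Progressions with progression images\<close>

text \<open>If all three terms carry the same weight \<open>w\<close>, the second difference of the
  images is \<open>2 * w * d\<^sup>2\<close>. Switching the weight of one term alters this by 25
  times its square, up to sign, and by twice that for the middle term. So every mixed pattern yields
  one of the four forms, in \<open>d\<close> and the odd term out.\<close>

lemma half_square_map_AP:
  assumes ac: "[c = b + d] (mod int p)" "[a = b - d] (mod int p)"
    and eq: "[half_square_map p c + half_square_map p a = 2 * half_square_map p b] (mod int p)"
  shows "int p dvd d"
proof -
  define w :: "int \<Rightarrow> int" where "w x = (if 2 * x < int p then 16 else - 9)" for x
  have hw: "half_square_map p x = w x * x\<^sup>2" for x
    by (simp add: half_square_map_def w_def)
  have "[w c * c\<^sup>2 + w a * a\<^sup>2 = w c * (b + d)\<^sup>2 + w a * (b - d)\<^sup>2] (mod int p)"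
    using ac by (intro cong_add cong_mult cong_pow cong_refl)
  then have "[w c * (b + d)\<^sup>2 + w a * (b - d)\<^sup>2 = 2 * (w b * b\<^sup>2)] (mod int p)"
    using eq unfolding hw by (metis cong_sym cong_trans)
  then have dvd: "int p dvd w c * (b + d)\<^sup>2 + w a * (b - d)\<^sup>2 - 2 * (w b * b\<^sup>2)"
    by (simp add: cong_iff_dvd_diff)
  have w: "w x = 16 \<or> w x = - 9" for x
    by (simp add: w_def)
  consider (low) "w a = 16" "w b = 16" "w c = 16" | (high) "w a = -9" "w b = -9" "w c = -9"
    | (mid1) "w a = 16" "w b = -9" "w c = 16" | (mid2) "w a = -9" "w b = 16" "w c = -9"
    | (c1) "w a = 16" "w b = 16" "w c = -9" | (c2) "w a = -9" "w b = -9" "w c = 16"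
    | (a1) "w a = -9" "w b = 16" "w c = 16" | (a2) "w a = 16" "w b = -9" "w c = -9"
    using w[of a] w[of b] w[of c] by argo
  then show ?thesis
  proof cases
    case low
    then have "w c * (b + d)\<^sup>2 + w a * (b - d)\<^sup>2 - 2 * (w b * b\<^sup>2) = 32 * d\<^sup>2"
      by (simp add: power2_eq_square algebra_simps)
    then show ?thesis
      using dvd dvd_square_cancel(1) by metis
  next
    case high
    then have "w c * (b + d)\<^sup>2 + w a * (b - d)\<^sup>2 - 2 * (w b * b\<^sup>2) = - (18 * d\<^sup>2)"
      by (simp add: power2_eq_square algebra_simps)
    then show ?thesis
      using dvd dvd_square_cancel(2) by (metis dvd_minus_iff)
  next
    case mid1
    then have "w c * (b + d)\<^sup>2 + w a * (b - d)\<^sup>2 - 2 * (w b * b\<^sup>2) = 2 * (25 * b\<^sup>2 + 16 * d\<^sup>2)"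
      by (simp add: power2_eq_square algebra_simps)
    then show ?thesis
      using dvd dvd_if_dvd_quadratic_form(1) dvd_cancel(1)[of "25 * b\<^sup>2 + 16 * d\<^sup>2"] by metis
  next
    case mid2
    then have "w c * (b + d)\<^sup>2 + w a * (b - d)\<^sup>2 - 2 * (w b * b\<^sup>2) = - (2 * (25 * b\<^sup>2 + 9 * d\<^sup>2))"
      by (simp add: power2_eq_square algebra_simps)
    then show ?thesis
      using dvd dvd_if_dvd_quadratic_form(2) dvd_cancel(1)[of "25 * b\<^sup>2 + 9 * d\<^sup>2"] by (metis dvd_minus_iff)
  next
    case c1
    \<comment> \<open>The odd term out is \<open>c\<close>, so the square is completed around
      \<open>b + d\<close>.\<close>
    then have "w c * (b + d)\<^sup>2 + w a * (b - d)\<^sup>2 - 2 * (w b * b\<^sup>2) = - (25 * (b + d)\<^sup>2 - 32 * d\<^sup>2)"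
      by (simp add: power2_eq_square algebra_simps)
    then show ?thesis
      using dvd dvd_if_dvd_quadratic_form(3) by (metis dvd_minus_iff)
  next
    case c2
    then have "w c * (b + d)\<^sup>2 + w a * (b - d)\<^sup>2 - 2 * (w b * b\<^sup>2) = 25 * (b + d)\<^sup>2 - 18 * d\<^sup>2"
      by (simp add: power2_eq_square algebra_simps)
    then show ?thesis
      using dvd dvd_if_dvd_quadratic_form(4) by metis
  next
    case a1
    \<comment> \<open>Mirror image of \<open>c1\<close>: reversing the progression turns
      \<open>d\<close> into \<open>- d\<close>, and the odd term out is \<open>a\<close>.\<close>
    then have "w c * (b + d)\<^sup>2 + w a * (b - d)\<^sup>2 - 2 * (w b * b\<^sup>2)
        = - (25 * (b + (- d))\<^sup>2 - 32 * (- d)\<^sup>2)"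
      by (simp add: power2_eq_square algebra_simps)
    then show ?thesis
      using dvd dvd_if_dvd_quadratic_form(3) by (metis dvd_minus_iff)
  next
    case a2
    then have "w c * (b + d)\<^sup>2 + w a * (b - d)\<^sup>2 - 2 * (w b * b\<^sup>2)
        = 25 * (b + (- d))\<^sup>2 - 18 * (- d)\<^sup>2"
      by (simp add: power2_eq_square algebra_simps)
    then show ?thesis
      using dvd dvd_if_dvd_quadratic_form(4) by (metis dvd_minus_iff)
  qed
qed

section \<open>Bijectivity\<close>

text \<open>Squaring identifies only \<open>x\<close> and \<open>-x\<close>, and a nonzero residue
  and its negative lie in different halves.\<close>

lemma eq_if_dvd_square_diff:
  assumes xy: "x \<in> {0..int p - 1}" "y \<in> {0..int p - 1}"
    and half: "2 * x < int p \<longleftrightarrow> 2 * y < int p" and dvd: "int p dvd x\<^sup>2 - y\<^sup>2"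
  shows "x = y"
proof -
  have "int p dvd (x - y) * (x + y)"
    using dvd by (simp add: power2_eq_square algebra_simps)
  then consider "int p dvd x - y" | "int p dvd x + y"
    using prime_int_p prime_dvd_multD by blast
  then show ?thesis
  proof cases
    case 1
    then have "[x = y] (mod int p)"
      by (simp add: cong_iff_dvd_diff)
    then show ?thesis
      using xy by (simp add: cong_def)
  next
    case 2
    then obtain q where q: "x + y = int p * q" ..
    have "int p * q < int p * 2" "int p * 0 \<le> int p * q"
      unfolding q[symmetric] using xy by simp_all
    moreover have "0 < int p"
      using p_gt_3 by simp
    ultimately have "q < 2" "0 \<le> q"
      using mult_less_cancel_left_pos mult_le_cancel_left_pos by blast+
    then consider "q = 0" | "q = 1"
      by linarith
    then show ?thesis
    proof cases
      case 1
      then show ?thesis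
        using q xy by simp
    next
      case 2
      then have "x + y = int p"
        using q by simp
      \<comment> \<open>Two numbers on the same side of \<open>p / 2\<close> with sum
        \<open>p\<close> must both equal \<open>p / 2\<close>.\<close>
      then have "2 * x = int p \<and> 2 * y = int p"
        using half by linarith
      then show ?thesis
        by linarith
    qed
  qed
qed

lemma inj_on_half_square_map: "inj_on (\<lambda>x. half_square_map p x mod int p) {0..int p - 1}"
proof (rule inj_onI)
  fix x y
  assume xy: "x \<in> {0..int p - 1}" "y \<in> {0..int p - 1}"
    and eq: "half_square_map p x mod int p = half_square_map p y mod int p"
  have dvd: "int p dvd half_square_map p x - half_square_map p y"
    using eq by (simp add: mod_eq_dvd_iff)
  \<comment> \<open>A collision between the halves reads
    \<open>16 * u\<^sup>2 = - 9 * v\<^sup>2\<close>, that is,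
    \<open>(4 * u)\<^sup>2 + (3 * v)\<^sup>2\<close> vanishes modulo \<open>p\<close>.\<close>
  have zero: "u = 0 \<and> v = 0"
    if "u \<in> {0..int p - 1}" "v \<in> {0..int p - 1}" "int p dvd 16 * u\<^sup>2 + 9 * v\<^sup>2" for u v
  proof -
    have "int p dvd 4 * u" "int p dvd 3 * v"
      using sum_squares_zeroD[of "4 * u" "3 * v"] that by (simp_all add: power_mult_distrib)
    then have "int p dvd u" "int p dvd v"
      using dvd_cancel(3)[of u] dvd_cancel(2)[of v] by simp_all
    then have "u mod int p = 0" "v mod int p = 0"
      by simp_all
    then show ?thesis
      using that by simp
  qed
  consider (low) "2 * x < int p" "2 * y < int p" | (high) "\<not> 2 * x < int p" "\<not> 2 * y < int p"
    | (xlow) "2 * x < int p" "\<not> 2 * y < int p" | (ylow) "\<not> 2 * x < int p" "2 * y < int p"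
    by blast
  then show "x = y"
  proof cases
    case low
    then have "half_square_map p x - half_square_map p y = 4 * (4 * (x\<^sup>2 - y\<^sup>2))"
      by (simp add: half_square_map_def)
    then have "int p dvd x\<^sup>2 - y\<^sup>2"
      using dvd dvd_cancel(3)[OF dvd_cancel(3)] by metis
    then show ?thesis
      using low eq_if_dvd_square_diff[OF xy] by simp
  next
    case high
    then have "half_square_map p x - half_square_map p y = - (3 * (3 * (x\<^sup>2 - y\<^sup>2)))"
      by (simp add: half_square_map_def)
    then have "int p dvd x\<^sup>2 - y\<^sup>2"
      using dvd dvd_cancel(2)[OF dvd_cancel(2)] by (metis dvd_minus_iff)
    then show ?thesis
      using high eq_if_dvd_square_diff[OF xy] by simp
  next
    case xlow
    then show ?thesis
      using dvd zero[OF xy] by (simp add: half_square_map_def)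
  next
    case ylow
    then have "half_square_map p x - half_square_map p y = - (16 * y\<^sup>2 + 9 * x\<^sup>2)"
      by (simp add: half_square_map_def)
    then show ?thesis
      using dvd zero[OF xy(2,1)] by (metis dvd_minus_iff)
  qed
qed

lemma bij_betw_half_square_map:
  "bij_betw (\<lambda>x. half_square_map p x mod int p) {0..int p - 1} {0..int p - 1}"
proof -
  have "(\<lambda>x. half_square_map p x mod int p) ` {0..int p - 1} \<subseteq> {0..int p - 1}"
    using p_gt_3 by auto
  then show ?thesis
    using inj_on_half_square_map endo_inj_surj by (metis bij_betw_def finite_atLeastAtMost_int)
qed

section \<open>Transfer to the ring of residues\<close>

lemma destroys_half_square_map:
  "destroys_arithmetic_progressions (residue_ring (int p)) (\<lambda>x. half_square_map p x mod int p)"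
proof -
  interpret residues "int p" "residue_ring (int p)"
    using p_gt_3 by unfold_locales auto
  have minus: "x \<ominus>\<^bsub>residue_ring (int p)\<^esub> y = (x - y) mod int p" for x y
    by (simp add: a_minus_def res_add_eq res_neg_eq mod_simps)
  show ?thesis
    unfolding destroys_arithmetic_progressions_def minus res_carrier_eq res_eq_to_cong
  proof clarify
    fix a b c
    assume abc: "a \<in> {0..int p - 1}" "b \<in> {0..int p - 1}" "c \<in> {0..int p - 1}"
      and AP: "[c - b = b - a] (mod int p)"
      and ne: "\<not> (a = b \<and> b = c)"
      and "[half_square_map p c mod int p - half_square_map p b mod int p =
         half_square_map p b mod int p - half_square_map p a mod int p] (mod int p)"
    then have "[half_square_map p c - half_square_map p b =
         half_square_map p b - half_square_map p a] (mod int p)"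
      by (simp add: cong_def mod_simps)
    then have "[half_square_map p c + half_square_map p a = 2 * half_square_map p b] (mod int p)"
      by (simp add: cong_iff_dvd_diff algebra_simps)
    \<comment> \<open>The common difference is taken to be \<open>b - a\<close>; \<open>c\<close>
      follows it only modulo \<open>p\<close>, since the progression may wrap around.\<close>
    moreover have "[c = b + (b - a)] (mod int p)" "[a = b - (b - a)] (mod int p)"
      using AP by (simp_all add: cong_iff_dvd_diff algebra_simps)
    ultimately have d: "int p dvd b - a"
      using half_square_map_AP by blast
    then have "int p dvd c - b"
      using AP cong_dvd_iff by blast
    then have "b mod int p = a mod int p" "c mod int p = b mod int p"
      using d by (simp_all add: mod_eq_dvd_iff)
    then show False
      using abc ne by simp
  qed
qed

end

theorem theorem1p2:
  fixes p :: nat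
  assumes "prime p" and "p > 3" and "[p = 3] (mod 8)"
  shows "\<exists>\<pi>. bij_betw \<pi> (carrier (residue_ring (int p))) (carrier (residue_ring (int p))) \<and>
             destroys_arithmetic_progressions (residue_ring (int p)) \<pi>"
proof -
  interpret prime_3_mod_8 p
    using assms by unfold_locales
  have "carrier (residue_ring (int p)) = {0..int p - 1}"
    by (simp add: residue_ring_def)
  then show ?thesis
    using bij_betw_half_square_map destroys_half_square_map by metis
qed

end
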